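(* Let $a,b,c$ be positive integers, let $w_0,w_1$ be arbitrary, and let $\{w_n\}$ be defined by $w_n=aw_{n-1}+cw_{n-2}$ for $n\ge2$ even and $w_n=bw_{n-1}+cw_{n-2}$ for $n\ge2$ odd. Let $\{v_n\}$ satisfy the same recurrence with $v_0=2$, $v_1=b$. For integers $n,m,r,d>0$ we have $$w_{(m+2r)n+d}=v_m^{-n}\sum_{i+j+s=n}\binom{n}{i,j}(-1)^s(-c)^{mj+(m+r)s}v_r^{j}w_{2(m+r)i+rj+d}\left(\frac ab\right)^{\xi(r)\frac{j+\xi(j)}{2}-\xi(m)\frac{n+\xi(n)}{2}-\xi(rj)\xi(d)+\xi(mn)\xi(d)}$$ and $$w_{2(m+r)n+d}=\sum_{i+j+s=n}\binom{n}{i,j}(-1)^j(-c)^{s(m+r)+mj}v_m^{i}v_r^{j}w_{(m+2r)i+rj+d}\left(\frac ab\right)^{\xi(m)\frac{i+\xi(i)}{2}+\xi(r)\frac{j+\xi(j)}{2}-\xi(mi)\xi(rj)-\xi(mi+rj)\xi(d)},$$ where the sums run over nonnegative integers $i,j,s$ with $i+j+s=n$.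
   Context: $\xi(n)=n-2\lfloor n/2\rfloor$ is the parity function. $\binom{n}{i,j}:=\frac{n!}{i!\,j!\,(n-i-j)!}$. *)

theory Defs
  imports Complex_Main
begin

definition parity :: "nat \<Rightarrow> int" where
  "parity n = int n - 2 * (int n div 2)"

text \<open>The recurrence says nothing about the initial values \<open>w 0\<close> and \<open>w 1\<close>.\<close>

definition biperiodic_rec :: "nat \<Rightarrow> nat \<Rightarrow> nat \<Rightarrow> (nat \<Rightarrow> 'a::field_char_0) \<Rightarrow> bool" where
  "biperiodic_rec a b c w \<longleftrightarrow>
     (\<forall>n\<ge>2. w n = (if even n then of_nat a else of_nat b) * w (n - 1) + of_nat c * w (n - 2))"

text \<open>Meant for \<open>i + j \<le> n\<close>; beyond that the subtraction truncates.\<close>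

definition trinomial :: "nat \<Rightarrow> nat \<Rightarrow> nat \<Rightarrow> 'a::field_char_0" where
  "trinomial n i j = fact n / (fact i * fact j * fact (n - i - j))"

text \<open>\<open>half_up j\<close> is the exponent \<open>(j + \<xi>(j)) / 2\<close>; the integer division is exact
  because \<open>j + parity j\<close> is even.\<close>

definition half_up :: "nat \<Rightarrow> int" where
  "half_up j = (int j + parity j) div 2"

end

theory Submission
  imports Defs
begin

text \<open>
  Put \<open>q = a / b\<close>. The rescaled sequence \<open>W n = w n / q ^ (n div 2)\<close> satisfies the recurrence
  \<open>W (n + 2) = b * W (n + 1) + C * W n\<close> with constant coefficients, \<open>C = c / q\<close>, and \<open>v\<close> rescales
  to its Lucas sequence \<open>V\<close>. Eliminating \<open>W (N + 2 * r)\<close> between two instances of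
  \<open>V r * W (n + r) = W (n + 2 * r) + (- C) ^ r * W n\<close> gives
  \<open>V m * W (N + (m + 2 * r)) = W (N + 2 * (m + r)) + (- C) ^ m * V r * W (N + r) - (- C) ^ (m + r) * W N\<close>.
  Both identities are the \<open>n\<close>-th power of this relation between shift operators, expanded by the
  trinomial theorem; the powers of \<open>a / b\<close> in the statement undo the rescaling.
\<close>

section \<open>The trinomial theorem for shift relations\<close>

lemma finite_triples_sum_eq: "finite {(i, j, s). i + j + s = (n::nat)}"
  by (rule finite_subset[of _ "{..n} \<times> {..n} \<times> {..n}"]) auto

lemma trinomial_eq:
  "i + j + s = n \<Longrightarrow> trinomial n i j = fact n / (fact i * fact j * fact s)"
  by (auto simp: trinomial_def)

text \<open>Pascal's rule in summed form. After multiplication by \<open>Suc n = i + j + s\<close>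
  the left side splits into three sums; absorbing the factor \<open>i\<close>, \<open>j\<close> or
  \<open>s\<close> into the trinomial coefficient lowers it to level \<open>n\<close>, and
  \<open>Suc n\<close> cancels in characteristic zero.\<close>

lemma sum_trinomial_Suc:
  fixes g :: "nat \<Rightarrow> nat \<Rightarrow> nat \<Rightarrow> 'a::field_char_0"
  shows "(\<Sum>(i, j, s) \<in> {(i, j, s). i + j + s = Suc n}. trinomial (Suc n) i j * g i j s) =
    (\<Sum>(i, j, s) \<in> {(i, j, s). i + j + s = n}.
       trinomial n i j * (g (Suc i) j s + g i (Suc j) s + g i j (Suc s)))"
proof -
  let ?T = "\<lambda>n. {(i, j, s). i + j + s = (n::nat)}"
  define t :: "nat \<Rightarrow> nat \<Rightarrow> nat \<Rightarrow> 'a" where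
    "t i j s = fact (i + j + s) / (fact i * fact j * fact s)" for i j s
  have absorb1: "of_nat (Suc i) * t (Suc i) j s = of_nat (Suc n) * t i j s"
    if "i + j + s = n" for i j s
    using that by (simp add: t_def divide_simps del: of_nat_Suc)
  have absorb2: "of_nat (Suc j) * t i (Suc j) s = of_nat (Suc n) * t i j s"
    if "i + j + s = n" for i j s
    using that by (simp add: t_def divide_simps del: of_nat_Suc)
  have absorb3: "of_nat (Suc s) * t i j (Suc s) = of_nat (Suc n) * t i j s"
    if "i + j + s = n" for i j s
    using that by (simp add: t_def divide_simps del: of_nat_Suc)
  \<comment> \<open>The shift misses only the triples with \<open>i = 0\<close> on the right, and
    there the weight \<open>of_nat i\<close> vanishes; likewise for \<open>j\<close> and
    \<open>s\<close> below.\<close>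
  have shift1: "(\<Sum>(i, j, s) \<in> ?T n. of_nat (Suc n) * t i j s * g (Suc i) j s) =
      (\<Sum>(i, j, s) \<in> ?T (Suc n). of_nat i * t i j s * g i j s)"
    by (rule sum.reindex_bij_witness_not_neutral[where S' = "{}"
          and T' = "{(i, j, s) \<in> ?T (Suc n). i = 0}"
          and i = "\<lambda>(i, j, s). (i - 1, j, s)" and j = "\<lambda>(i, j, s). (Suc i, j, s)"])
       (auto intro: finite_subset[OF _ finite_triples_sum_eq[of "Suc n"]] simp: absorb1
         simp del: of_nat_Suc)
  have shift2: "(\<Sum>(i, j, s) \<in> ?T n. of_nat (Suc n) * t i j s * g i (Suc j) s) =
      (\<Sum>(i, j, s) \<in> ?T (Suc n). of_nat j * t i j s * g i j s)"
    by (rule sum.reindex_bij_witness_not_neutral[where S' = "{}"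
          and T' = "{(i, j, s) \<in> ?T (Suc n). j = 0}"
          and i = "\<lambda>(i, j, s). (i, j - 1, s)" and j = "\<lambda>(i, j, s). (i, Suc j, s)"])
       (auto intro: finite_subset[OF _ finite_triples_sum_eq[of "Suc n"]] simp: absorb2
         simp del: of_nat_Suc)
  have shift3: "(\<Sum>(i, j, s) \<in> ?T n. of_nat (Suc n) * t i j s * g i j (Suc s)) =
      (\<Sum>(i, j, s) \<in> ?T (Suc n). of_nat s * t i j s * g i j s)"
    by (rule sum.reindex_bij_witness_not_neutral[where S' = "{}"
          and T' = "{(i, j, s) \<in> ?T (Suc n). s = 0}"
          and i = "\<lambda>(i, j, s). (i, j, s - 1)" and j = "\<lambda>(i, j, s). (i, j, Suc s)"])
       (auto intro: finite_subset[OF _ finite_triples_sum_eq[of "Suc n"]] simp: absorb3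
         simp del: of_nat_Suc)
  have "of_nat (Suc n) * (\<Sum>(i, j, s) \<in> ?T (Suc n). trinomial (Suc n) i j * g i j s) =
      (\<Sum>(i, j, s) \<in> ?T (Suc n). (of_nat i + of_nat j + of_nat s) * t i j s * g i j s)"
    unfolding sum_distrib_left
    by (rule sum.cong) (auto simp: trinomial_eq t_def simp flip: of_nat_add)
  also have "\<dots> = of_nat (Suc n) * (\<Sum>(i, j, s) \<in> ?T n.
      trinomial n i j * (g (Suc i) j s + g i (Suc j) s + g i j (Suc s)))"
  proof -
    have "(\<Sum>(i, j, s) \<in> ?T (Suc n). (of_nat i + of_nat j + of_nat s) * t i j s * g i j s) =
      (\<Sum>(i, j, s) \<in> ?T (Suc n). of_nat i * t i j s * g i j s) +
      (\<Sum>(i, j, s) \<in> ?T (Suc n). of_nat j * t i j s * g i j s) +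
      (\<Sum>(i, j, s) \<in> ?T (Suc n). of_nat s * t i j s * g i j s)"
      unfolding sum.distrib[symmetric] by (rule sum.cong) (auto simp: algebra_simps)
    also have "\<dots> = of_nat (Suc n) * (\<Sum>(i, j, s) \<in> ?T n.
      trinomial n i j * (g (Suc i) j s + g i (Suc j) s + g i j (Suc s)))"
      unfolding shift1[symmetric] shift2[symmetric] shift3[symmetric] sum.distrib[symmetric] sum_distrib_left
      by (rule sum.cong) (auto simp: trinomial_eq t_def algebra_simps add_divide_distrib simp del: of_nat_Suc)
    finally show ?thesis .
  qed
  finally show ?thesis
    by (simp del: of_nat_Suc)
qed

text \<open>The hypothesis trades one step in \<open>l\<close> for one step in \<open>i\<close>,
  \<open>j\<close> or \<open>s\<close>, as for an operator that is a sum of three commuting ones.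
  The induction on \<open>n\<close> uses its hypothesis at \<open>Suc l\<close>, so \<open>l\<close>
  stays arbitrary.\<close>

lemma trinomial_expansion:
  fixes G :: "nat \<Rightarrow> nat \<Rightarrow> nat \<Rightarrow> nat \<Rightarrow> 'a::field_char_0"
  assumes "\<And>l i j s. G (Suc l) i j s = G l (Suc i) j s + G l i (Suc j) s + G l i j (Suc s)"
  shows "G (l + n) 0 0 0 = (\<Sum>(i, j, s) \<in> {(i, j, s). i + j + s = n}. trinomial n i j * G l i j s)"
proof (induction n arbitrary: l)
  case 0
  have "{(i, j, s). i = 0 \<and> j = 0 \<and> s = (0::nat)} = {(0::nat, 0::nat, 0)}"
    by auto
  then show ?case
    by (simp add: trinomial_def)
next
  case (Suc n)
  have "G (l + Suc n) 0 0 0 = G (Suc l + n) 0 0 0"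
    by simp
  also note Suc.IH
  finally show ?case
    unfolding assms sum_trinomial_Suc .
qed

lemma shift_power_expansion:
  fixes f :: "nat \<Rightarrow> 'a::field_char_0"
  assumes "\<And>N. \<kappa> * f (N + A) = \<alpha> * f (N + B) + \<beta> * f (N + D) + \<gamma> * f N"
  shows "\<kappa> ^ n * f (A * n + d) = (\<Sum>(i, j, s) \<in> {(i, j, s). i + j + s = n}.
    trinomial n i j * (\<alpha> ^ i * \<beta> ^ j * \<gamma> ^ s * f (B * i + D * j + d)))"
proof -
  \<comment> \<open>\<open>l\<close> counts uses of the left side of the relation, and
    \<open>i\<close>, \<open>j\<close>, \<open>s\<close> count uses of its three right-hand
    terms.\<close>
  define G where "G l i j s = \<kappa> ^ l * \<alpha> ^ i * \<beta> ^ j * \<gamma> ^ s * f (A * l + B * i + D * j + d)"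
    for l i j s
  have "G (Suc l) i j s = G l (Suc i) j s + G l i (Suc j) s + G l i j (Suc s)" for l i j s
  proof -
    let ?N = "A * l + B * i + D * j + d"
    have "G (Suc l) i j s = \<kappa> ^ l * \<alpha> ^ i * \<beta> ^ j * \<gamma> ^ s * (\<kappa> * f (?N + A))"
      by (simp add: G_def algebra_simps)
    then show ?thesis
      unfolding assms by (simp add: G_def algebra_simps)
  qed
  from trinomial_expansion[of G 0 n, OF this] show ?thesis
    by (simp add: G_def)
qed

section \<open>Linear recurrences and their Lucas sequences\<close>

definition linear_rec :: "'a::comm_ring_1 \<Rightarrow> 'a \<Rightarrow> (nat \<Rightarrow> 'a) \<Rightarrow> bool" where
  "linear_rec p c f \<longleftrightarrow> (\<forall>n. f (n + 2) = p * f (n + 1) + c * f n)"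

text \<open>With \<open>x\<close>, \<open>y\<close> the roots of \<open>t^2 = p * t + c\<close>, one
  has \<open>x * y = - c\<close> and \<open>V r = x^r + y^r\<close>; for \<open>f n = x^n\<close>
  the claim is \<open>(x^r + y^r) * x^(n + r) = x^(n + 2 * r) + (x * y)^r * x^n\<close>. The
  two-step induction avoids the roots.\<close>

lemma lucas_mult:
  fixes f V :: "nat \<Rightarrow> 'a::comm_ring_1"
  assumes f: "linear_rec p c f" and V: "linear_rec p c V" "V 0 = 2" "V 1 = p"
  shows "V r * f (n + r) = f (n + 2 * r) + (- c) ^ r * f n"
proof (induction r arbitrary: n rule: induct_nat_012)
  case 0
  then show ?case
    using V by simp
next
  case 1
  then show ?case
    using V f[unfolded linear_rec_def, rule_format, of n] by simp
next
  case (ge2 r)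
  \<comment> \<open>The recurrence lowers the index of \<open>V\<close> but not that of
    \<open>f\<close>, so the induction hypotheses are needed at \<open>n + 1\<close> and
    \<open>n + 2\<close>.\<close>
  have "V (Suc (Suc r)) * f (n + Suc (Suc r)) =
      p * (V (Suc r) * f (Suc n + Suc r)) + c * (V r * f (Suc (Suc n) + r))"
    using V(1)[unfolded linear_rec_def, rule_format, of r] by (simp add: algebra_simps)
  also have "\<dots> = (p * f (n + 2 * r + 2 + 1) + c * f (n + 2 * r + 2))
      + (- c) ^ r * c * (f (n + 2) - p * f (n + 1))"
    unfolding ge2 by (simp add: algebra_simps)
  also have "\<dots> = f (n + 2 * r + 2 + 2) + (- c) ^ r * c * (c * f n)"
    using f unfolding linear_rec_def by simp
  also have "\<dots> = f (n + 2 * Suc (Suc r)) + (- c) ^ Suc (Suc r) * f n"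
    by (simp add: algebra_simps)
  finally show ?case .
qed

lemma lucas_three_term:
  fixes f V :: "nat \<Rightarrow> 'a::comm_ring_1"
  assumes "linear_rec p c f" "linear_rec p c V" "V 0 = 2" "V 1 = p"
  shows "V m * f (N + (m + 2 * r)) =
    f (N + 2 * (m + r)) + (- c) ^ m * V r * f (N + r) - (- c) ^ (m + r) * f N"
proof -
  have "f (N + 2 * r) = V r * f (N + r) - (- c) ^ r * f N"
    using lucas_mult[OF assms, of r N] by simp
  moreover have "V m * f (N + (m + 2 * r)) = f (N + 2 * (m + r)) + (- c) ^ m * f (N + 2 * r)"
    using lucas_mult[OF assms, of m "N + 2 * r"] by (simp add: algebra_simps)
  ultimately show ?thesis
    by (simp only: right_diff_distrib power_add mult.assoc add_diff_eq)
qed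

section \<open>Rescaling and positivity of biperiodic sequences\<close>

lemma biperiodic_rec_rescale:
  fixes w :: "nat \<Rightarrow> 'a::field_char_0"
  assumes "a > 0" "b > 0" and w: "biperiodic_rec a b c w"
  defines "q \<equiv> of_nat a / of_nat b"
  shows "linear_rec (of_nat b) (of_nat c / q) (\<lambda>n. w n / q ^ (n div 2))"
  unfolding linear_rec_def
proof
  fix n
  have q: "q \<noteq> 0" "of_nat b * q = of_nat a"
    using assms by auto
  have "w (n + 2) = (if even n then of_nat a else of_nat b) * w (n + 1) + of_nat c * w n"
    using w[unfolded biperiodic_rec_def, rule_format, of "n + 2"] by simp
  \<comment> \<open>The exponent grows by one exactly on reaching an even index, where
    \<open>a / q = b\<close> absorbs it; over two steps it always grows by one, which turns
    \<open>c\<close> into \<open>c / q\<close>.\<close>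
  then show "w (n + 2) / q ^ ((n + 2) div 2) =
      of_nat b * (w (n + 1) / q ^ ((n + 1) div 2)) + of_nat c / q * (w n / q ^ (n div 2))"
    using q(1) by (cases "even n") (auto elim!: evenE oddE simp: field_simps simp flip: q(2))
qed

text \<open>Permits division by powers of \<open>v m\<close>. The field carries no order, so
  positivity is that of a natural number, whose image is nonzero in characteristic zero.\<close>

lemma biperiodic_rec_pos:
  fixes v :: "nat \<Rightarrow> 'a::field_char_0"
  assumes "a > 0" "b > 0" "biperiodic_rec a b c v" "v 0 = 2" "v 1 = of_nat b"
  shows "\<exists>k>0. v n = of_nat k"
proof (induction n rule: induct_nat_012)
  case 0
  show ?case
    using assms by (intro exI[of _ 2]) simp
next
  case 1
  show ?case
    using assms by auto
next
  case (ge2 n)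
  then obtain k l where "k > 0" "v n = of_nat k" "l > 0" "v (Suc n) = of_nat l"
    by auto
  with assms(1-3) show ?case
    unfolding biperiodic_rec_def
    by (intro exI[of _ "(if even n then a else b) * l + c * k"]) (auto simp: add_pos_pos)
qed

section \<open>Floors, ceilings and parities\<close>

lemma div2_double_add: "(2 * x + y) div 2 = x + y div (2::nat)"
  by simp

lemma parity_eq: "parity n = int (n mod 2)"
  by (simp add: parity_def zmod_int minus_div_mult_eq_mod[symmetric])

lemma half_up_eq: "half_up n = int n - int (n div 2)"
proof -
  have "int ((n + n mod 2) div 2) = int n - int (n div 2)"
    by presburger
  then show ?thesis
    by (simp only: half_up_def parity_eq zdiv_int of_nat_add of_nat_numeral)
qed

text \<open>\<open>half_up\<close> is the ceiling of half its argument, and the even part of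
  \<open>r\<close> contributes the integer \<open>j * (r div 2)\<close> to that of
  \<open>r * j\<close>. This integer is also the exponent of \<open>q\<close> in the rescaling of
  \<open>v r ^ j\<close>.\<close>

lemma parity_mult_half_up: "parity r * half_up j = half_up (r * j) - int j * int (r div 2)"
proof (cases "even r")
  case True
  then show ?thesis
    by (auto elim!: evenE simp: parity_eq half_up_eq)
next
  case False
  then obtain k where k: "r = 2 * k + 1"
    by (elim oddE)
  have "(r * j) div 2 = k * j + j div 2"
    by (simp add: k algebra_simps)
  moreover have "parity r = 1"
    by (simp add: k parity_eq)
  ultimately show ?thesis
    by (simp add: k half_up_eq algebra_simps)
qed

text \<open>The product of parities is the carry out of the lowest binary digit; it accounts for the
  products of two parities in the exponents of \<open>a / b\<close>.\<close>

lemma div2_add: "int ((x + d) div 2) = int (x div 2) + int (d div 2) + parity x * parity d"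
  unfolding parity_eq
  by (cases "even x"; cases "even d") (auto elim!: evenE oddE)

section \<open>The two identities\<close>

theorem theorem5:
  fixes a b c :: nat
    and w v :: "nat \<Rightarrow> 'a::field_char_0"
    and n m r d :: nat
  assumes "a > 0" and "b > 0" and "c > 0"
    and "biperiodic_rec a b c w"
    and "biperiodic_rec a b c v" and "v 0 = 2" and "v 1 = of_nat b"
    and "n > 0" and "m > 0" and "r > 0" and "d > 0"
  shows
    "w ((m + 2 * r) * n + d) =
       v m powi (- int n) *
       (\<Sum>(i, j, s) \<in> {(i, j, s). i + j + s = n}.
          trinomial n i j * (-1) ^ s * (- of_nat c) ^ (m * j + (m + r) * s) * v r ^ j
          * w (2 * (m + r) * i + r * j + d)
          * (of_nat a / of_nat b) powi
              (parity r * half_up j - parity m * half_up n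
               - parity (r * j) * parity d + parity (m * n) * parity d)) \<and>
     w (2 * (m + r) * n + d) =
       (\<Sum>(i, j, s) \<in> {(i, j, s). i + j + s = n}.
          trinomial n i j * (-1) ^ j * (- of_nat c) ^ (s * (m + r) + m * j) * v m ^ i * v r ^ j
          * w ((m + 2 * r) * i + r * j + d)
          * (of_nat a / of_nat b) powi
              (parity m * half_up i + parity r * half_up j
               - parity (m * i) * parity (r * j) - parity (m * i + r * j) * parity d))"
proof -
  define q :: 'a where "q = of_nat a / of_nat b"
  define C where "C = of_nat c / q"
  define W where "W n = w n / q ^ (n div 2)" for n
  define V where "V n = v n / q ^ (n div 2)" for n
  have q: "q \<noteq> 0"
    using assms by (simp add: q_def)
  \<comment> \<open>Integer powers let all factors \<open>q\<close> merge into one exponent, which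
    may have negative terms.\<close>
  have w_eq: "w n = q powi int (n div 2) * W n" and v_eq: "v n = q powi int (n div 2) * V n" for n
    using q by (simp_all add: W_def V_def)
  have c_eq: "(- of_nat c) ^ n = q powi int n * (- C) ^ n" for n
    using q by (simp add: C_def flip: power_mult_distrib)
  have v_pow_eq: "v n ^ k = q powi (int k * int (n div 2)) * V n ^ k" for n k
    unfolding v_eq by (simp add: power_mult_distrib mult.commute flip: power_mult of_nat_mult)
  have "linear_rec (of_nat b) C W" "linear_rec (of_nat b) C V" "V 0 = 2" "V 1 = of_nat b"
    using biperiodic_rec_rescale[OF assms(1,2)] assms
    unfolding W_def V_def C_def q_def by simp_all
  note three_term = lucas_three_term[OF this]

  have v_nz: "v m ^ n \<noteq> 0"
    using biperiodic_rec_pos[OF assms(1,2,5-7), of m] by auto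
  have expansion: "V m ^ n * W ((m + 2 * r) * n + d) = (\<Sum>(i, j, s) \<in> {(i, j, s). i + j + s = n}.
      trinomial n i j * (1 ^ i * ((- C) ^ m * V r) ^ j * (- ((- C) ^ (m + r))) ^ s
        * W (2 * (m + r) * i + r * j + d)))"
    by (rule shift_power_expansion) (simp add: three_term)
  have "v m ^ n * w ((m + 2 * r) * n + d) =
      q powi (int n * int (m div 2) + int (((m + 2 * r) * n + d) div 2)) *
      (V m ^ n * W ((m + 2 * r) * n + d))"
    unfolding v_pow_eq w_eq[of "(m + 2 * r) * n + d"] power_int_add[OF disjI1[OF q]]
    by (simp only: mult_ac)
  also have "\<dots> = (\<Sum>(i, j, s) \<in> {(i, j, s). i + j + s = n}.
          trinomial n i j * (-1) ^ s * (- of_nat c) ^ (m * j + (m + r) * s) * v r ^ j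
          * w (2 * (m + r) * i + r * j + d)
          * q powi (parity r * half_up j - parity m * half_up n
               - parity (r * j) * parity d + parity (m * n) * parity d))"
    unfolding expansion sum_distrib_left
  proof (rule sum.cong[OF refl], goal_cases)
    case (1 x)
    then obtain i j s where x: "x = (i, j, s)" and n: "n = i + j + s"
      by auto
    let ?M = "m * j + (m + r) * s" and ?x = "2 * (m + r) * i + r * j + d"
    let ?E = "parity r * half_up j - parity m * half_up n
      - parity (r * j) * parity d + parity (m * n) * parity d"
    have "?x = 2 * ((m + r) * i) + (r * j + d)"
      by (simp add: algebra_simps)
    then have 1: "?x div 2 = (m + r) * i + (r * j + d) div 2"
      by (simp only: div2_double_add)
    have "(m + 2 * r) * n + d = 2 * (r * n) + (m * n + d)"
      by (simp add: algebra_simps)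
    then have 2: "((m + 2 * r) * n + d) div 2 = r * n + (m * n + d) div 2"
      by (simp only: div2_double_add)
    \<comment> \<open>Comparison of the exponents of \<open>q\<close>: carries and floors cancel,
      leaving \<open>r * n = ?M + (m + r) * i + r * j - m * n\<close>.\<close>
    have e: "int n * int (m div 2) + int (((m + 2 * r) * n + d) div 2) =
        int ?M + int j * int (r div 2) + int (?x div 2) + ?E"
      unfolding 1 2 of_nat_add div2_add parity_mult_half_up unfolding half_up_eq
      by (simp add: n algebra_simps)
    have p: "1 ^ i * ((- C) ^ m * V r) ^ j * (- ((- C) ^ (m + r))) ^ s =
        (-1) ^ s * (- C) ^ ?M * V r ^ j"
      unfolding power_minus[of "(- C) ^ (m + r)"]
      unfolding power_mult_distrib power_add power_mult power_one
      by (simp only: mult_ac mult_1_left)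
    show ?case
      unfolding x prod.case
      unfolding e p c_eq v_pow_eq w_eq[of ?x] power_int_add[OF disjI1[OF q]]
      by (simp only: mult_ac)
  qed
  finally have first: "v m ^ n * w ((m + 2 * r) * n + d) = \<dots>" .

  \<comment> \<open>The same relation solved for its term at \<open>N + 2 * (m + r)\<close>, whose
    coefficient is 1, so no division occurs.\<close>
  have expansion: "1 ^ n * W (2 * (m + r) * n + d) = (\<Sum>(i, j, s) \<in> {(i, j, s). i + j + s = n}.
      trinomial n i j * (V m ^ i * (- ((- C) ^ m * V r)) ^ j * ((- C) ^ (m + r)) ^ s
        * W ((m + 2 * r) * i + r * j + d)))"
    by (rule shift_power_expansion) (simp add: three_term)
  have "w (2 * (m + r) * n + d) =
      q powi int ((2 * (m + r) * n + d) div 2) * (1 ^ n * W (2 * (m + r) * n + d))"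
    by (simp only: w_eq[of "2 * (m + r) * n + d"] power_one mult_1_left)
  also have "\<dots> = (\<Sum>(i, j, s) \<in> {(i, j, s). i + j + s = n}.
          trinomial n i j * (-1) ^ j * (- of_nat c) ^ (s * (m + r) + m * j) * v m ^ i * v r ^ j
          * w ((m + 2 * r) * i + r * j + d)
          * q powi (parity m * half_up i + parity r * half_up j
               - parity (m * i) * parity (r * j) - parity (m * i + r * j) * parity d))"
    unfolding expansion sum_distrib_left
  proof (rule sum.cong[OF refl], goal_cases)
    case (1 x)
    then obtain i j s where x: "x = (i, j, s)" and n: "n = i + j + s"
      by auto
    let ?M = "s * (m + r) + m * j" and ?x = "(m + 2 * r) * i + r * j + d"
    let ?E = "parity m * half_up i + parity r * half_up j
      - parity (m * i) * parity (r * j) - parity (m * i + r * j) * parity d"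
    have "?x = 2 * (r * i) + (m * i + r * j + d)"
      by (simp add: algebra_simps)
    then have 1: "?x div 2 = r * i + (m * i + r * j + d) div 2"
      by (simp only: div2_double_add)
    have "2 * (m + r) * n + d = 2 * ((m + r) * n) + d"
      by (simp only: mult.assoc)
    then have 2: "(2 * (m + r) * n + d) div 2 = (m + r) * n + d div 2"
      by (simp only: div2_double_add)
    \<comment> \<open>Halving the three-term sum \<open>m * i + r * j + d\<close> yields two
      carries, which are the two products subtracted in \<open>?E\<close>.\<close>
    have e: "int ((2 * (m + r) * n + d) div 2) =
        int ?M + int i * int (m div 2) + int j * int (r div 2) + int (?x div 2) + ?E"
      unfolding 1 2 of_nat_add div2_add parity_mult_half_up unfolding half_up_eq
      by (simp add: n algebra_simps)
    have p: "V m ^ i * (- ((- C) ^ m * V r)) ^ j * ((- C) ^ (m + r)) ^ s =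
        (-1) ^ j * (- C) ^ ?M * V m ^ i * V r ^ j"
      unfolding power_minus[of "(- C) ^ m * V r"]
      unfolding power_mult_distrib power_add power_mult
        mult.commute[of s]
      by (simp only: mult_ac)
    show ?case
      unfolding x prod.case
      unfolding e p c_eq v_pow_eq w_eq[of ?x] power_int_add[OF disjI1[OF q]]
      by (simp only: mult_ac)
  qed
  finally show ?thesis
    using first v_nz by (simp add: q_def power_int_minus field_simps)
qed

end
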